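(* Let $\mathcal{N}_0\in\mathcal{L}(C,C')$ be a fixed quantum channel and let $\Theta_0:\mathcal{L}(A,A')\to\mathcal{L}(C,C')$ be the replacer superchannel $\Theta_0(X):=|A|^{-1}\mathrm{tr}(\widehat{\mathsf C}_X)\,\mathcal{N}_0$ for all $X\in\mathcal{L}(A,A')$, where $\widehat{\mathsf C}_X$ is the Choi operator of $X$. Then $$S[\Theta_0]\ \le\ S[\mathcal{N}_0]+\log|A|.$$
   Context: All Hilbert spaces are finite-dimensional; $|A|=\dim A$. $\mathcal{L}(A)$ is the space of linear operators on $A$, $\mathcal{L}(A,B)$ the space of linear maps $\mathcal{L}(A)\to\mathcal{L}(B)$; $\mathcal{L}(A,B)_+$ denotes the set of quantum channels (CPTP maps) in it. The Choi operator of $X\in\mathcal{L}(A,B)$ is $\widehat{\mathsf C}_X=\sum_{i,j}e_{ij}\otimes X(e_{ij})$ ($e_{ij}$ matrix units of $\mathcal{L}(A)$). A superchannel is a linear map $\Theta:\mathcal{L}(A,B)\to\mathcal{L}(C,D)$ that is completely CP-preserving ($\mathrm{id}\otimes\Theta$ maps CP maps to CP maps, for the identity on any $\mathcal{L}(E,E')$) and TP-preserving (maps trace-preserving maps to trace-preserving maps). For $\rho$ a state and $\sigma\ge0$, $D(\rho\|\sigma)=\mathrm{tr}(\rho(\log\rho-\log\sigma))$ if $\mathrm{supp}\,\rho\subseteq\mathrm{supp}\,\sigma$ and $+\infty$ otherwise (same logarithm base throughout). For a channel $\mathcal{N}$ and a CP map $\mathcal{M}$ in $\mathcal{L}(A,B)$,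 $D[\mathcal{N}\|\mathcal{M}]=\sup_{\rho_{RA}}D(\mathrm{id}_R\otimes\mathcal{N}(\rho_{RA})\|\mathrm{id}_R\otimes\mathcal{M}(\rho_{RA}))$ over all reference systems $R$ and states on $R\otimes A$. With $\mathcal{R}_{A\to B}(Y)=\mathrm{tr}(Y)\mathbb{1}_B$, the entropy of a channel $\mathcal{N}_{A\to B}$ is $S[\mathcal{N}]=-D[\mathcal{N}\|\mathcal{R}_{A\to B}]$. For a superchannel $\Theta$ and a completely CP-preserving supermap $\Gamma$, both $\mathcal{L}(A,B)\to\mathcal{L}(C,D)$, $D^{(2)}[\Theta\|\Gamma]=\sup_{R,\ \mathcal{N}\in\mathcal{L}(R\otimes A,R\otimes B)_+}D[(\mathrm{id}\otimes\Theta)(\mathcal{N})\|(\mathrm{id}\otimes\Gamma)(\mathcal{N})]$, with $R$ an arbitrary Hilbert space and $\mathrm{id}$ the identity supermap on $\mathcal{L}(R,R)$. The completely depolarizing supermap is $\mathcal{R}^{(2)}(X)=\mathrm{tr}(\widehat{\mathsf C}_X)\,\mathcal{R}_{C\to D}$, and the entropy of a superchannel is $S[\Theta]:=-D^{(2)}[\Theta\|\mathcal{R}^{(2)}]$. *)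

theory Defs
  imports
    Complex_Main
    "HOL-Library.FuncSet"
    "HOL-Library.Extended_Real"
    "Jordan_Normal_Form.Matrix_Kernel"
    "Jordan_Normal_Form.Schur_Decomposition"
begin

text \<open>
  A finite-dimensional Hilbert space is represented by its dimension \<open>n\<close>, i.e. by \<open>\<complex>\<^sup>n\<close> with its
  standard basis; \<open>\<L>(\<complex>\<^sup>n)\<close> is \<^term>\<open>carrier_mat n n :: complex mat set\<close>.  Since dimensions are
  numbers and not types, the suprema over all reference systems below are suprema over all
  \<open>r > 0\<close>. The tensor product of \<open>\<complex>\<^sup>n\<close> and \<open>\<complex>\<^sup>m\<close> is \<open>\<complex>\<close> to the power \<open>n * m\<close>, the basis vector
  \<open>e\<^sub>i \<otimes> e\<^sub>p\<close> having index \<open>i * m + p\<close>.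
\<close>

subsection \<open>Operators\<close>

definition mat_trace :: "complex mat \<Rightarrow> complex" where
  "mat_trace A = (\<Sum>i<dim_row A. A $$ (i, i))"

text \<open>On \<^typ>\<open>complex\<close>, \<open>0 \<le> z\<close> means that \<open>z\<close> is real and nonnegative.\<close>

definition psd :: "nat \<Rightarrow> complex mat set" where
  "psd n = {A \<in> carrier_mat n n. \<forall>v \<in> carrier_vec n. 0 \<le> (A *\<^sub>v v) \<bullet>c v}"

definition states :: "nat \<Rightarrow> complex mat set" where
  "states n = {\<rho> \<in> psd n. mat_trace \<rho> = 1}"

definition supp :: "complex mat \<Rightarrow> complex vec set" where
  "supp A = {v \<in> carrier_vec (dim_row A). \<forall>w \<in> mat_kernel A. v \<bullet>c w = 0}"

text \<open>
  The logarithm to base \<open>b\<close> of a positive semidefinite matrix, by functional calculus: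
  \<open>log (U diag(d) U\<^sup>*) = U diag(log d) U\<^sup>*\<close> for unitary \<open>U\<close>.  The value does not depend on the
  diagonalisation.  The logarithm is taken on the support only, i.e. it is \<open>0\<close> on the kernel.
\<close>

definition mat_log :: "real \<Rightarrow> complex mat \<Rightarrow> complex mat" where
  "mat_log b A = (THE L. \<exists>U d. let n = dim_row A in
     U \<in> carrier_mat n n \<and> mat_adjoint U * U = 1\<^sub>m n \<and> (\<forall>i<n. 0 \<le> d i) \<and>
     A = U * mat_diag n (\<lambda>i. complex_of_real (d i)) * mat_adjoint U \<and>
     L = U * mat_diag n (\<lambda>i. complex_of_real (if d i = 0 then 0 else log b (d i))) * mat_adjoint U)"

definition rel_entropy :: "real \<Rightarrow> complex mat \<Rightarrow> complex mat \<Rightarrow> ereal" where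
  "rel_entropy b \<rho> \<sigma> =
     (if supp \<rho> \<subseteq> supp \<sigma> then ereal (Re (mat_trace (\<rho> * (mat_log b \<rho> - mat_log b \<sigma>)))) else \<infinity>)"

text \<open>\<open>tensor_sum n m F\<close> is \<open>\<Sum>\<^sub>i\<^sub>j e\<^sub>i\<^sub>j \<otimes> F i j\<close>, where \<open>F i j \<in> \<L>(\<complex>\<^sup>m)\<close> for \<open>i, j < n\<close>.
  Conversely \<open>tensor_block m Z i j\<close> is the coefficient of \<open>e\<^sub>i\<^sub>j\<close> in \<open>Z = \<Sum>\<^sub>i\<^sub>j e\<^sub>i\<^sub>j \<otimes> Z\<^sub>i\<^sub>j\<close>.\<close>

definition tensor_sum :: "nat \<Rightarrow> nat \<Rightarrow> (nat \<Rightarrow> nat \<Rightarrow> complex mat) \<Rightarrow> complex mat" where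
  "tensor_sum n m F =
     mat (n * m) (n * m) (\<lambda>(p, q). F (p div m) (q div m) $$ (p mod m, q mod m))"

definition tensor_block :: "nat \<Rightarrow> complex mat \<Rightarrow> nat \<Rightarrow> nat \<Rightarrow> complex mat" where
  "tensor_block m Z i j = mat m m (\<lambda>(p, q). Z $$ (i * m + p, j * m + q))"

definition matrix_unit :: "nat \<Rightarrow> nat \<Rightarrow> nat \<Rightarrow> complex mat" where
  "matrix_unit n i j = mat n n (\<lambda>(p, q). if p = i \<and> q = j then 1 else 0)"

subsection \<open>Linear maps between operator spaces and channels\<close>

text \<open>\<open>lin_maps n m\<close> is \<open>\<L>(\<complex>\<^sup>n, \<complex>\<^sup>m)\<close>.  Maps are extensional, so that equality of HOL functions
  is equality of linear maps.\<close>

definition lin_maps :: "nat \<Rightarrow> nat \<Rightarrow> (complex mat \<Rightarrow> complex mat) set" where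
  "lin_maps n m = {N \<in> carrier_mat n n \<rightarrow>\<^sub>E carrier_mat m m.
     (\<forall>X \<in> carrier_mat n n. \<forall>Y \<in> carrier_mat n n. N (X + Y) = N X + N Y) \<and>
     (\<forall>z. \<forall>X \<in> carrier_mat n n. N (z \<cdot>\<^sub>m X) = z \<cdot>\<^sub>m N X)}"

definition scale_map ::
  "nat \<Rightarrow> complex \<Rightarrow> (complex mat \<Rightarrow> complex mat) \<Rightarrow> complex mat \<Rightarrow> complex mat" where
  "scale_map n z N = (\<lambda>X \<in> carrier_mat n n. z \<cdot>\<^sub>m N X)"

text \<open>\<open>id_tensor r n m N\<close> is \<open>id \<otimes> N\<close> with the identity on \<open>\<L>(\<complex>\<^sup>r)\<close>:
  \<open>\<Sum>\<^sub>i\<^sub>j e\<^sub>i\<^sub>j \<otimes> X\<^sub>i\<^sub>j\<close> is mapped to \<open>\<Sum>\<^sub>i\<^sub>j e\<^sub>i\<^sub>j \<otimes> N X\<^sub>i\<^sub>j\<close>.\<close>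

definition id_tensor ::
  "nat \<Rightarrow> nat \<Rightarrow> nat \<Rightarrow> (complex mat \<Rightarrow> complex mat) \<Rightarrow> complex mat \<Rightarrow> complex mat" where
  "id_tensor r n m N =
     (\<lambda>X \<in> carrier_mat (r * n) (r * n). tensor_sum r m (\<lambda>i j. N (tensor_block n X i j)))"

definition completely_positive :: "nat \<Rightarrow> nat \<Rightarrow> (complex mat \<Rightarrow> complex mat) \<Rightarrow> bool" where
  "completely_positive n m N \<longleftrightarrow> (\<forall>r>0. \<forall>X \<in> psd (r * n). id_tensor r n m N X \<in> psd (r * m))"

definition trace_preserving :: "nat \<Rightarrow> (complex mat \<Rightarrow> complex mat) \<Rightarrow> bool" where
  "trace_preserving n N \<longleftrightarrow> (\<forall>X \<in> carrier_mat n n. mat_trace (N X) = mat_trace X)"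

definition channels :: "nat \<Rightarrow> nat \<Rightarrow> (complex mat \<Rightarrow> complex mat) set" where
  "channels n m = {N \<in> lin_maps n m. completely_positive n m N \<and> trace_preserving n N}"

definition choi :: "nat \<Rightarrow> nat \<Rightarrow> (complex mat \<Rightarrow> complex mat) \<Rightarrow> complex mat" where
  "choi n m N = tensor_sum n m (\<lambda>i j. N (matrix_unit n i j))"

definition channel_divergence ::
  "real \<Rightarrow> nat \<Rightarrow> nat \<Rightarrow> (complex mat \<Rightarrow> complex mat) \<Rightarrow> (complex mat \<Rightarrow> complex mat) \<Rightarrow> ereal" where
  "channel_divergence b n m N M =
     (SUP r \<in> {0<..}. SUP \<rho> \<in> states (r * n).
        rel_entropy b (id_tensor r n m N \<rho>) (id_tensor r n m M \<rho>))"

definition depolarizing :: "nat \<Rightarrow> nat \<Rightarrow> complex mat \<Rightarrow> complex mat" where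
  "depolarizing n m = (\<lambda>X \<in> carrier_mat n n. mat_trace X \<cdot>\<^sub>m 1\<^sub>m m)"

definition channel_entropy ::
  "real \<Rightarrow> nat \<Rightarrow> nat \<Rightarrow> (complex mat \<Rightarrow> complex mat) \<Rightarrow> ereal" where
  "channel_entropy b n m N = - channel_divergence b n m N (depolarizing n m)"

subsection \<open>Supermaps\<close>

type_synonym supermap = "(complex mat \<Rightarrow> complex mat) \<Rightarrow> complex mat \<Rightarrow> complex mat"

text \<open>
  Let \<open>E\<^sub>i\<^sub>j\<^sub>k\<^sub>l \<in> \<L>(\<complex>\<^sup>r, \<complex>\<^sup>r)\<close> be the map \<open>X \<mapsto> X\<^sub>i\<^sub>j e\<^sub>k\<^sub>l\<close>; these maps are a basis.  Every
  \<open>N \<in> \<L>(\<complex>\<^sup>r \<otimes> \<complex>\<^sup>a, \<complex>\<^sup>r \<otimes> \<complex>\<^sup>b)\<close> is uniquely \<open>\<Sum>\<^sub>i\<^sub>j\<^sub>k\<^sub>l E\<^sub>i\<^sub>j\<^sub>k\<^sub>l \<otimes> N\<^sub>i\<^sub>j\<^sub>k\<^sub>l\<close>, where \<open>N\<^sub>i\<^sub>j\<^sub>k\<^sub>l X\<close> is the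
  coefficient of \<open>e\<^sub>k\<^sub>l\<close> in \<open>N (e\<^sub>i\<^sub>j \<otimes> X)\<close>, and \<open>(id \<otimes> \<Theta>) N = \<Sum>\<^sub>i\<^sub>j\<^sub>k\<^sub>l E\<^sub>i\<^sub>j\<^sub>k\<^sub>l \<otimes> \<Theta> N\<^sub>i\<^sub>j\<^sub>k\<^sub>l\<close>.
\<close>

definition map_component ::
  "nat \<Rightarrow> nat \<Rightarrow> nat \<Rightarrow> (complex mat \<Rightarrow> complex mat) \<Rightarrow>
   nat \<Rightarrow> nat \<Rightarrow> nat \<Rightarrow> nat \<Rightarrow> complex mat \<Rightarrow> complex mat" where
  "map_component r a b N i j k l =
     (\<lambda>X \<in> carrier_mat a a.
        tensor_block b (N (tensor_sum r a (\<lambda>p q. if p = i \<and> q = j then X else 0\<^sub>m a a))) k l)"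

definition id_tensor_super ::
  "nat \<Rightarrow> nat \<Rightarrow> nat \<Rightarrow> nat \<Rightarrow> nat \<Rightarrow> supermap \<Rightarrow> supermap" where
  "id_tensor_super r a b c d \<Theta> N =
     (\<lambda>Y \<in> carrier_mat (r * c) (r * c). tensor_sum r d (\<lambda>k l. mat d d (\<lambda>pq.
        \<Sum>i<r. \<Sum>j<r. \<Theta> (map_component r a b N i j k l) (tensor_block c Y i j) $$ pq)))"

definition superchannel_divergence ::
  "real \<Rightarrow> nat \<Rightarrow> nat \<Rightarrow> nat \<Rightarrow> nat \<Rightarrow> supermap \<Rightarrow> supermap \<Rightarrow> ereal" where
  "superchannel_divergence base a b c d \<Theta> \<Gamma> =
     (SUP r \<in> {0<..}. SUP N \<in> channels (r * a) (r * b).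
        channel_divergence base (r * c) (r * d)
          (id_tensor_super r a b c d \<Theta> N) (id_tensor_super r a b c d \<Gamma> N))"

definition depolarizing_super :: "nat \<Rightarrow> nat \<Rightarrow> nat \<Rightarrow> nat \<Rightarrow> supermap" where
  "depolarizing_super a b c d X = scale_map c (mat_trace (choi a b X)) (depolarizing c d)"

definition superchannel_entropy ::
  "real \<Rightarrow> nat \<Rightarrow> nat \<Rightarrow> nat \<Rightarrow> nat \<Rightarrow> supermap \<Rightarrow> ereal" where
  "superchannel_entropy base a b c d \<Theta> =
     - superchannel_divergence base a b c d \<Theta> (depolarizing_super a b c d)"

definition replacer_superchannel ::
  "nat \<Rightarrow> nat \<Rightarrow> nat \<Rightarrow> (complex mat \<Rightarrow> complex mat) \<Rightarrow> supermap" where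
  "replacer_superchannel a b c N\<^sub>0 X = scale_map c (mat_trace (choi a b X) / of_nat a) N\<^sub>0"

end

theory Submission
  imports Defs "Jordan_Normal_Form.Spectral_Radius"
begin

text \<open>
  Feed \<open>\<Theta>\<^sub>0\<close> and the depolarizing supermap a single channel \<open>N\<close> with trivial reference system.
  The Choi operator of a channel on \<open>\<L>(A)\<close> has trace \<open>|A|\<close>, so the outputs are \<open>N\<^sub>0\<close> and
  \<open>|A|\<close> times the depolarizing map.  Scaling the second argument of the relative entropy by
  \<open>|A|\<close> lowers it by \<open>log |A|\<close>, so the divergence of the supermaps is at least that of the
  channels minus \<open>log |A|\<close>.
\<close>

text \<open>The relative entropy uses logarithms of operators that may be singular, with value 0 on
  the kernel. Hence the logarithm of c sigma is that of sigma plus (log c) P, where P projects onto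
  the support of sigma, and not plus (log c) 1. The shift comes out of the trace because an
  inclusion of supports gives rho P = rho and tr rho = 1; without the inclusion both divergences are
  infinite. Since \<open>mat_log\<close> is a definite description, computing with it requires the
  spectral theorem for existence and, for uniqueness, that the functional calculus does not depend
  on the diagonalisation. Complete positivity of the depolarizing map serves twice: it makes the
  second argument of the relative entropy positive semidefinite, and it makes the normalised
  depolarizing map a channel. The latter is the explicit channel that bounds the supremum from
  below.\<close>

subsection \<open>Adjoints and positive semidefinite matrices\<close>

lemma mat_adjoint_dim [simp]:
  "dim_row (mat_adjoint A) = dim_col A" "dim_col (mat_adjoint A) = dim_row A"
  by (simp_all add: mat_adjoint_def)

lemma mat_adjoint_index [simp]:
  fixes A :: "complex mat"
  assumes "i < dim_col A" "j < dim_row A"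
  shows "mat_adjoint A $$ (i, j) = cnj (A $$ (j, i))"
  using assms by (simp add: mat_adjoint_def mat_of_rows_def)

lemma mat_adjoint_carrier [simp]:
  "A \<in> carrier_mat n m \<Longrightarrow> mat_adjoint A \<in> carrier_mat m n"
  by (auto intro!: carrier_matI)

lemma mat_adjoint_adjoint [simp]: "mat_adjoint (mat_adjoint A) = (A :: complex mat)"
  by (rule eq_matI) auto

lemma mat_adjoint_mult:
  fixes A :: "complex mat"
  assumes "A \<in> carrier_mat n m" "B \<in> carrier_mat m k"
  shows "mat_adjoint (A * B) = mat_adjoint B * mat_adjoint A"
  using assms by (intro eq_matI) (auto simp: scalar_prod_def intro!: sum.cong)

lemma cscalar_prod_sum:
  fixes v w :: "complex vec"
  assumes "v \<in> carrier_vec n" "w \<in> carrier_vec n"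
  shows "v \<bullet>c w = (\<Sum>i<n. v $ i * cnj (w $ i))"
  using assms by (auto simp: scalar_prod_def lessThan_atLeast0 intro!: sum.cong)

lemma mult_mat_vec_sum:
  assumes "A \<in> carrier_mat n m" "v \<in> carrier_vec m" "i < n"
  shows "(A *\<^sub>v v) $ i = (\<Sum>j<m. A $$ (i, j) * v $ j)"
  using assms by (auto simp: scalar_prod_def lessThan_atLeast0 intro!: sum.cong)

lemma sesquilinear_form_sum:
  fixes A :: "complex mat"
  assumes "A \<in> carrier_mat n m" "v \<in> carrier_vec m" "w \<in> carrier_vec n"
  shows "(A *\<^sub>v v) \<bullet>c w = (\<Sum>i<n. \<Sum>j<m. A $$ (i, j) * v $ j * cnj (w $ i))"
proof -
  have "A *\<^sub>v v \<in> carrier_vec n" using assms by auto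
  then show ?thesis
    using assms(3) by (subst cscalar_prod_sum[of _ n])
      (auto simp: mult_mat_vec_sum[OF assms(1,2)] sum_distrib_right simp del: index_mult_mat_vec)
qed

lemma cscalar_prod_adjoint:
  fixes A :: "complex mat"
  assumes "A \<in> carrier_mat n m" "v \<in> carrier_vec m" "w \<in> carrier_vec n"
  shows "(A *\<^sub>v v) \<bullet>c w = v \<bullet>c (mat_adjoint A *\<^sub>v w)"
proof -
  have 1: "mat_adjoint A *\<^sub>v w \<in> carrier_vec m"
    using assms by (intro mult_mat_vec_carrier[of _ m n] mat_adjoint_carrier)
  have "v \<bullet>c (mat_adjoint A *\<^sub>v w) = (\<Sum>j<m. v $ j * cnj (\<Sum>i<n. mat_adjoint A $$ (j, i) * w $ i))"
    unfolding cscalar_prod_sum[OF assms(2) 1]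
    using assms by (intro sum.cong refl) (subst mult_mat_vec_sum, auto)
  also have "\<dots> = (\<Sum>j<m. \<Sum>i<n. A $$ (i, j) * v $ j * cnj (w $ i))"
    using assms by (auto simp: sum_distrib_left intro!: sum.cong)
  also have "\<dots> = (A *\<^sub>v v) \<bullet>c w"
    unfolding sesquilinear_form_sum[OF assms] by (rule sum.swap)
  finally show ?thesis ..
qed

lemma psd_carrier: "A \<in> psd n \<Longrightarrow> A \<in> carrier_mat n n"
  by (simp add: psd_def)

lemma sesquilinear_form_unit_vec:
  fixes A :: "complex mat"
  assumes "A \<in> carrier_mat n n" "i < n" "j < n"
  shows "(A *\<^sub>v unit_vec n j) \<bullet>c unit_vec n i = A $$ (i, j)"
proof -
  have "(A *\<^sub>v unit_vec n j) \<bullet>c unit_vec n i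
      = (\<Sum>k<n. \<Sum>l<n. A $$ (k, l) * unit_vec n j $ l * cnj (unit_vec n i $ k))"
    by (rule sesquilinear_form_sum[OF assms(1)]) auto
  also have "\<dots> = (\<Sum>k<n. if k = i then (\<Sum>l<n. if l = j then A $$ (k, l) else 0) else 0)"
  proof (intro sum.cong refl)
    fix k assume k: "k \<in> {..<n}"
    have "(\<Sum>l<n. A $$ (k, l) * unit_vec n j $ l * cnj (unit_vec n i $ k))
        = (\<Sum>l<n. if l = j then (if k = i then A $$ (k, l) else 0) else 0)"
      using k by (intro sum.cong refl) (auto simp: unit_vec_def)
    then show "(\<Sum>l<n. A $$ (k, l) * unit_vec n j $ l * cnj (unit_vec n i $ k))
        = (if k = i then (\<Sum>l<n. if l = j then A $$ (k, l) else 0) else 0)"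
      by auto
  qed
  also have "\<dots> = A $$ (i, j)" using assms by simp
  finally show ?thesis .
qed

text \<open>\<open>psd\<close> asks only that the quadratic form be real and nonnegative. Over the
  complex numbers this forces hermiticity by polarization: the form is evaluated at e_i + z e_j and
  the real diagonal terms drop out of the imaginary part.\<close>

lemma psd_hermitian:
  assumes "A \<in> psd n"
  shows "mat_adjoint A = A"
proof -
  have A: "A \<in> carrier_mat n n" using assms by (rule psd_carrier)
  note B = sesquilinear_form_unit_vec[OF A]
  have *: "Im (z * A $$ (i, j) + cnj z * A $$ (j, i)) = 0" if ij: "i < n" "j < n" for i j z
  proof -
    let ?x = "unit_vec n i :: complex vec" and ?y = "z \<cdot>\<^sub>v unit_vec n j"
    have c: "?x \<in> carrier_vec n" "?y \<in> carrier_vec n" "unit_vec n j \<in> carrier_vec n"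
      "A *\<^sub>v ?x \<in> carrier_vec n" "A *\<^sub>v unit_vec n j \<in> carrier_vec n"
      "conjugate ?x \<in> carrier_vec n"  "conjugate (unit_vec n j :: complex vec) \<in> carrier_vec n"
      using A by auto
    have "(A *\<^sub>v (?x + ?y)) \<bullet>c (?x + ?y)
        = (A *\<^sub>v ?x + z \<cdot>\<^sub>v (A *\<^sub>v unit_vec n j)) \<bullet> (conjugate ?x + cnj z \<cdot>\<^sub>v conjugate (unit_vec n j))"
      using c by (simp add: mult_add_distrib_mat_vec[OF A] mult_mat_vec[OF A] conjugate_add_vec[of _ n]
          conjugate_smult_vec)
    also have "\<dots> = (A *\<^sub>v ?x) \<bullet>c ?x + cnj z * ((A *\<^sub>v ?x) \<bullet>c unit_vec n j)
        + z * ((A *\<^sub>v unit_vec n j) \<bullet>c ?x) + z * cnj z * ((A *\<^sub>v unit_vec n j) \<bullet>c unit_vec n j)"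
      using c by (simp add: add_scalar_prod_distrib[of _ n] scalar_prod_add_distrib[of _ n] algebra_simps)
    also have "\<dots> = A $$ (i, i) + cnj z * A $$ (j, i) + z * A $$ (i, j) + z * cnj z * A $$ (j, j)"
      using ij by (simp add: B)
    finally have e: "(A *\<^sub>v (?x + ?y)) \<bullet>c (?x + ?y)
        = A $$ (i, i) + cnj z * A $$ (j, i) + z * A $$ (i, j) + z * cnj z * A $$ (j, j)" .
    have "0 \<le> (A *\<^sub>v (?x + ?y)) \<bullet>c (?x + ?y)" using assms c by (auto simp: psd_def)
    moreover have "0 \<le> A $$ (i, i)" "0 \<le> A $$ (j, j)"
      using assms c ij by (auto simp: psd_def B[symmetric])
    ultimately show ?thesis unfolding e by (simp add: less_eq_complex_def)
  qed
  show ?thesis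
  proof (rule eq_matI)
    fix i j assume "i < dim_row A" "j < dim_col A"
    then have ij: "i < n" "j < n" using A by auto
    \<comment> \<open>z = 1 equates Im A_ij with -Im A_ji, and z = i equates the real parts.\<close>
    show "mat_adjoint A $$ (i, j) = A $$ (i, j)"
      using *[OF ij, of 1] *[OF ij, of \<i>] ij A by (auto simp: complex_eq_iff)
  qed (use A in auto)
qed

text \<open>The form of the new matrix at v is the form of \<open>A\<close> at W v.\<close>

lemma psd_congruence:
  assumes "A \<in> psd n" "W \<in> carrier_mat n m"
  shows "mat_adjoint W * A * W \<in> psd m"
proof -
  have A: "A \<in> carrier_mat n n" using assms by (rule_tac psd_carrier)
  have "0 \<le> (mat_adjoint W * A * W *\<^sub>v v) \<bullet>c v" if v: "v \<in> carrier_vec m" for v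
  proof -
    have w: "W *\<^sub>v v \<in> carrier_vec n" using assms v by auto
    have "mat_adjoint W * A * W *\<^sub>v v = mat_adjoint W *\<^sub>v (A *\<^sub>v (W *\<^sub>v v))"
      using assms A v w by (subst assoc_mult_mat_vec[of _ m n _ m], auto)
        (subst assoc_mult_mat_vec[of _ m n _ n], auto)
    also have "\<dots> \<bullet>c v = (A *\<^sub>v (W *\<^sub>v v)) \<bullet>c (W *\<^sub>v v)"
      using assms A v w by (subst cscalar_prod_adjoint[of _ m n]) auto
    finally show ?thesis using assms w by (simp add: psd_def)
  qed
  then show ?thesis using assms A by (auto simp: psd_def)
qed

subsection \<open>Diagonalisation\<close>

lemma unitary_adjoint_right:
  fixes U :: "complex mat"
  assumes "U \<in> carrier_mat n n" "mat_adjoint U * U = 1\<^sub>m n"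
  shows "U * mat_adjoint U = 1\<^sub>m n"
  using mat_mult_left_right_inverse[OF mat_adjoint_carrier[OF assms(1)] assms] .

text \<open>Gram-Schmidt leaves the first vector of a basis unchanged, so starting from a basis that
  begins with \<open>v\<close> keeps the direction of \<open>v\<close> in column 0.\<close>

lemma unitary_extending_vec:
  fixes v :: "complex vec"
  assumes v: "v \<in> carrier_vec n" "v \<noteq> 0\<^sub>v n" and n: "0 < n"
  obtains W c where "W \<in> carrier_mat n n" "mat_adjoint W * W = 1\<^sub>m n" "col W 0 = c \<cdot>\<^sub>v v"
proof -
  interpret cof_vec_space n "TYPE(complex)" .
  define b where "b = basis_completion v"
  define ws where "ws = gram_schmidt n b"
  note bc = basis_completion[OF v, folded b_def]
  then have len: "length b = n" by simp
  then obtain vs where bv: "b = v # vs" using bc(7) n by (cases b) auto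
  note gs = gram_schmidt_result[OF bc(2) bc(4) bc(5) ws_def]
  have hd: "ws ! 0 = v"
    using gram_schmidt_hd[OF v(1), of vs, folded bv, folded ws_def] gs(4) len n
    by (cases ws) auto
  have ws: "length ws = n" using gs len by simp
  have wsc: "ws ! i \<in> carrier_vec n" if "i < n" for i using gs(3) ws that by auto
  \<comment> \<open>Gram-Schmidt gives orthogonal but not normalised vectors; \<open>s w\<close> is
    the reciprocal of the norm of \<open>w\<close>.\<close>
  define s where "s w = complex_of_real (1 / sqrt (Re (w \<bullet>c w)))" for w :: "complex vec"
  define W where "W = mat_of_cols n (map (\<lambda>w. s w \<cdot>\<^sub>v w) ws)"
  have W: "W \<in> carrier_mat n n" using ws by (auto simp: W_def)
  have col: "col W i = s (ws ! i) \<cdot>\<^sub>v (ws ! i)" if "i < n" for i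
    unfolding W_def using that ws wsc by (subst col_mat_of_cols) auto
  have orth: "col W j \<bullet>c col W i = (if i = j then 1 else 0)" if ij: "i < n" "j < n" for i j
  proof -
    have "col W j \<bullet>c col W i = s (ws ! j) * s (ws ! i) * (ws ! j \<bullet>c ws ! i)"
      unfolding col[OF ij(1)] col[OF ij(2)]
      using wsc[OF ij(1)] wsc[OF ij(2)] by (simp add: conjugate_smult_vec s_def)
    also have "\<dots> = (if i = j then 1 else 0)"
    proof (cases "i = j")
      case False
      then show ?thesis using corthogonalD[OF gs(2)] ws ij by simp
    next
      case True
      have "ws ! i \<bullet>c ws ! i \<ge> 0" by (rule conjugate_square_ge_0_vec)
      \<comment> \<open>Orthogonality in the sense of \<open>corthogonal\<close> includes that no
        vector has norm 0, so the reciprocal in \<open>s\<close> is meaningful.\<close>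
      moreover have "ws ! i \<bullet>c ws ! i \<noteq> 0" using corthogonalD[OF gs(2)] ws ij by simp
      ultimately obtain r where r: "ws ! i \<bullet>c ws ! i = complex_of_real r" "0 < r"
        by (auto simp: less_eq_complex_def complex_eq_iff intro: that[of "Re (ws ! i \<bullet>c ws ! i)"])
      have "1 / sqrt r * (1 / sqrt r) * r = 1" using r(2) by (simp add: field_simps)
      then have "s (ws ! i) * s (ws ! i) * (ws ! i \<bullet>c ws ! i) = 1"
        unfolding s_def r(1) Re_complex_of_real of_real_mult[symmetric] by simp
      then show ?thesis using True by simp
    qed
    finally show ?thesis .
  qed
  have "mat_adjoint W * W = 1\<^sub>m n"
  proof (rule eq_matI)
    fix i j assume "i < dim_row (1\<^sub>m n :: complex mat)" "j < dim_col (1\<^sub>m n :: complex mat)"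
    then have ij: "i < n" "j < n" by auto
    have "(mat_adjoint W * W) $$ (i, j) = col W j \<bullet>c col W i"
      using ij W by (auto simp: scalar_prod_def intro!: sum.cong)
    then show "(mat_adjoint W * W) $$ (i, j) = 1\<^sub>m n $$ (i, j)"
      using ij orth by simp
  qed (use W in auto)
  then show ?thesis using that[OF W] col[OF n] hd by simp
qed

lemma psd_diag_nonneg:
  assumes "A \<in> psd n" "i < n"
  shows "0 \<le> A $$ (i, i)"
proof -
  have "unit_vec n i \<in> carrier_vec n" by simp
  then have "0 \<le> (A *\<^sub>v unit_vec n i) \<bullet>c unit_vec n i"
    using assms(1) unfolding psd_def by blast
  then show ?thesis
    unfolding sesquilinear_form_unit_vec[OF psd_carrier[OF assms(1)] assms(2,2)] .
qed

text \<open>Padding v with a leading 0 turns a form of the block into a form of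
  \<open>B\<close>.\<close>

lemma psd_lower_right:
  assumes "B \<in> psd (Suc n)"
  shows "mat n n (\<lambda>(i, j). B $$ (Suc i, Suc j)) \<in> psd n" (is "?C \<in> _")
proof -
  note B = psd_carrier[OF assms]
  have "0 \<le> (?C *\<^sub>v v) \<bullet>c v" if v: "v \<in> carrier_vec n" for v
  proof -
    have w: "vCons 0 v \<in> carrier_vec (Suc n)" using v by auto
    have "(?C *\<^sub>v v) \<bullet>c v = (B *\<^sub>v vCons 0 v) \<bullet>c vCons 0 v"
      unfolding sesquilinear_form_sum[OF B w w]
      using v by (subst sesquilinear_form_sum[of _ n n]) (auto simp: sum.lessThan_Suc_shift simp del: sum.lessThan_Suc)
    moreover have "0 \<le> (B *\<^sub>v vCons 0 v) \<bullet>c vCons 0 v"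
      using assms w unfolding psd_def by blast
    ultimately show ?thesis by simp
  qed
  then show ?thesis by (auto simp: psd_def)
qed

text \<open>Deflation: in a unitary basis that starts with an eigenvector, \<open>A\<close> splits
  into a 1 by 1 block and a smaller positive semidefinite block, to which the induction hypothesis
  applies.\<close>

theorem psd_diagonalisation:
  assumes "A \<in> psd n"
  shows "\<exists>U d. U \<in> carrier_mat n n \<and> mat_adjoint U * U = 1\<^sub>m n \<and> (\<forall>i<n. 0 \<le> (d i :: real)) \<and>
    A = U * mat_diag n (\<lambda>i. complex_of_real (d i)) * mat_adjoint U"
  using assms
proof (induction n arbitrary: A)
  case 0
  then have "A \<in> carrier_mat 0 0" by (rule psd_carrier)
  then show ?case by (intro exI[of _ "1\<^sub>m 0"] exI[of _ "\<lambda>_. 0"]) (auto intro!: eq_matI)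
next
  case (Suc n)
  note A = psd_carrier[OF Suc.prems]
  obtain e where "eigenvalue A e"
    using spectrum_non_empty[OF A] by (auto simp: spectrum_def)
  then obtain v where v: "v \<in> carrier_vec (Suc n)" "v \<noteq> 0\<^sub>v (Suc n)" "A *\<^sub>v v = e \<cdot>\<^sub>v v"
    using A by (auto simp: eigenvalue_def eigenvector_def)
  obtain W c where W: "W \<in> carrier_mat (Suc n) (Suc n)" "mat_adjoint W * W = 1\<^sub>m (Suc n)"
    "col W 0 = c \<cdot>\<^sub>v v"
    using unitary_extending_vec[OF v(1,2)] by blast
  note W' = mat_adjoint_carrier[OF W(1)]
  note WW' = unitary_adjoint_right[OF W(1,2)]
  define B where "B = mat_adjoint W * A * W"
  have Bpsd: "B \<in> psd (Suc n)" unfolding B_def by (rule psd_congruence[OF Suc.prems W(1)])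
  note B = psd_carrier[OF Bpsd]
  \<comment> \<open>Column 0 of \<open>W\<close> is still an eigenvector, and the adjoint of
    \<open>W\<close> sends it to the first basis vector.\<close>
  have "col B 0 = mat_adjoint W *\<^sub>v (A *\<^sub>v col W 0)"
    unfolding B_def assoc_mult_mat[OF W' A W(1)]
      col_mult2[OF W' mult_carrier_mat[OF A W(1)] zero_less_Suc] col_mult2[OF A W(1) zero_less_Suc] ..
  also have "\<dots> = e \<cdot>\<^sub>v (mat_adjoint W *\<^sub>v col W 0)"
    unfolding W(3) using v W' by (simp add: mult_mat_vec[OF A] mult_mat_vec[OF W'] smult_smult_assoc mult.commute)
  also have "mat_adjoint W *\<^sub>v col W 0 = unit_vec (Suc n) 0"
    using col_mult2[OF W' W(1), of 0] W(2) by simp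
  finally have col0: "col B 0 = e \<cdot>\<^sub>v unit_vec (Suc n) 0" .
  have B0: "B $$ (i, 0) = (if i = 0 then e else 0)" if "i < Suc n" for i
    using arg_cong[OF col0, of "\<lambda>x. x $ i"] that B by (auto simp: unit_vec_def)
  \<comment> \<open>Hermiticity carries the zeros of the first column over to the first row; this is
    what makes \<open>B\<close> block diagonal.\<close>
  have B0': "B $$ (0, i) = 0" if "i < Suc n" "i \<noteq> 0" for i
    using arg_cong[OF psd_hermitian[OF Bpsd], of "\<lambda>M. M $$ (0, i)"] B0[OF that(1)] that B by auto
  have "0 \<le> e" using psd_diag_nonneg[OF Bpsd, of 0] B0[of 0] by simp
  then have e: "e = complex_of_real (Re e)" "0 \<le> Re e" by (auto simp: less_eq_complex_def complex_eq_iff)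
  define C where "C = mat n n (\<lambda>(i, j). B $$ (Suc i, Suc j))"
  let ?E = "mat 1 1 (\<lambda>_. e)"
  have B_block: "B = four_block_mat ?E (0\<^sub>m 1 n) (0\<^sub>m n 1) C"
    using B B0 B0' by (intro eq_matI) (auto simp: C_def)
  have "C \<in> psd n" unfolding C_def by (rule psd_lower_right[OF Bpsd])
  then obtain U d where U: "U \<in> carrier_mat n n" "mat_adjoint U * U = 1\<^sub>m n"
    and d: "\<forall>i<n. 0 \<le> (d i :: real)"
    and C: "C = U * mat_diag n (\<lambda>i. complex_of_real (d i)) * mat_adjoint U"
    using Suc.IH by blast
  note U' = mat_adjoint_carrier[OF U(1)]
  define d' where "d' = case_nat (Re e) d"
  \<comment> \<open>\<open>V\<close> is 1 plus \<open>U\<close> as a direct sum; it diagonalises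
    \<open>B\<close>, so \<open>W * V\<close> diagonalises \<open>A\<close>.\<close>
  define V where "V = four_block_mat (1\<^sub>m 1) (0\<^sub>m 1 n) (0\<^sub>m n 1) U"
  define D where "D = mat_diag (Suc n) (\<lambda>i. complex_of_real (d' i))"
  have V: "V \<in> carrier_mat (Suc n) (Suc n)" using U by (auto simp: V_def)
  note V' = mat_adjoint_carrier[OF V]
  have D: "D \<in> carrier_mat (Suc n) (Suc n)" by (simp add: D_def)
  have V'_block: "mat_adjoint V = four_block_mat (1\<^sub>m 1) (0\<^sub>m 1 n) (0\<^sub>m n 1) (mat_adjoint U)"
    using U by (intro eq_matI) (auto simp: V_def)
  have D_block: "D = four_block_mat ?E (0\<^sub>m 1 n) (0\<^sub>m n 1) (mat_diag n (\<lambda>i. complex_of_real (d i)))"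
    using e(1) by (intro eq_matI) (auto simp: D_def d'_def mat_diag_def split: nat.splits)
  have V_unitary: "mat_adjoint V * V = 1\<^sub>m (Suc n)"
    unfolding V'_block unfolding V_def
    by (subst mult_four_block_mat[of _ 1 1 _ n _ n _ _ 1 _ n]) (use U U' in auto)
  let ?D = "mat_diag n (\<lambda>i. complex_of_real (d i))"
  have E: "?E \<in> carrier_mat 1 1" by simp
  note blk = mult_four_block_mat[of _ 1 1 _ n _ n _ _ 1 _ n]
  have "V * D = four_block_mat ?E (0\<^sub>m 1 n) (0\<^sub>m n 1) (U * ?D)"
    unfolding V_def D_block using U(1) E
    by (subst blk) (auto simp: left_mult_zero_mat[of ?D n n] left_mult_zero_mat[of ?E 1 1]
        right_mult_zero_mat[OF U(1)])
  moreover have "four_block_mat ?E (0\<^sub>m 1 n) (0\<^sub>m n 1) (U * ?D) * mat_adjoint V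
      = four_block_mat ?E (0\<^sub>m 1 n) (0\<^sub>m n 1) (U * ?D * mat_adjoint U)"
    unfolding V'_block using U(1) U' E mult_carrier_mat[OF U(1), of ?D n]
    by (subst blk) (auto simp: left_mult_zero_mat[OF U'] right_mult_zero_mat[of "U * ?D" n n])
  ultimately have B_VDV: "B = V * D * mat_adjoint V"
    unfolding B_block C by simp
  note assoc = assoc_mult_mat[of _ "Suc n" "Suc n" _ "Suc n" _ "Suc n"]
    and mc = mult_carrier_mat[of _ "Suc n" "Suc n" _ "Suc n"]
  have UVadj: "mat_adjoint (W * V) = mat_adjoint V * mat_adjoint W"
    by (rule mat_adjoint_mult[OF W(1) V])
  have "mat_adjoint (W * V) * (W * V) = mat_adjoint V * (mat_adjoint W * W) * V"
    unfolding UVadj using V V' W(1) W' by (simp add: assoc mc)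
  also have "\<dots> = 1\<^sub>m (Suc n)" using V V' by (simp add: W(2) V_unitary)
  finally have unit: "mat_adjoint (W * V) * (W * V) = 1\<^sub>m (Suc n)" .
  have "W * V * D * mat_adjoint (W * V) = W * (V * D * mat_adjoint V) * mat_adjoint W"
    unfolding UVadj using V V' W(1) W' D by (simp add: assoc mc)
  also have "\<dots> = (W * mat_adjoint W) * A * (W * mat_adjoint W)"
    unfolding B_VDV[symmetric] B_def
    using A W(1) W' by (simp add: assoc mc)
  also have "\<dots> = A" using A by (simp add: WW')
  finally have "A = W * V * D * mat_adjoint (W * V)" ..
  moreover have "\<forall>i<Suc n. 0 \<le> d' i" using d e by (auto simp: d'_def split: nat.splits)
  ultimately show ?case using unit W(1) V unfolding D_def
    by (intro exI[of _ "W * V"] exI[of _ d']) auto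
qed

subsection \<open>The logarithm and the relative entropy\<close>

text \<open>The change of basis W = V* U intertwines the two diagonal matrices. An intertwiner of
  diagonal matrices also intertwines their images under any \<open>f\<close>.\<close>

lemma diagonalisation_functional_calculus_unique:
  fixes U V :: "complex mat" and d e :: "nat \<Rightarrow> real"
  assumes U: "U \<in> carrier_mat n n" "mat_adjoint U * U = 1\<^sub>m n"
    and V: "V \<in> carrier_mat n n" "mat_adjoint V * V = 1\<^sub>m n"
    and eq: "U * mat_diag n (\<lambda>i. complex_of_real (d i)) * mat_adjoint U
           = V * mat_diag n (\<lambda>i. complex_of_real (e i)) * mat_adjoint V"
  shows "U * mat_diag n (\<lambda>i. complex_of_real (f (d i))) * mat_adjoint U
       = V * mat_diag n (\<lambda>i. complex_of_real (f (e i))) * mat_adjoint V"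
proof -
  note U' = mat_adjoint_carrier[OF U(1)] and V' = mat_adjoint_carrier[OF V(1)]
  note assoc = assoc_mult_mat[of _ n n _ n _ n] and mc = mult_carrier_mat[of _ n n _ n]
  note UU' = unitary_adjoint_right[OF U] and VV' = unitary_adjoint_right[OF V]
  define D where "D g = mat_diag n (\<lambda>i. complex_of_real (g i))" for g :: "nat \<Rightarrow> real"
  have D [simp]: "D g \<in> carrier_mat n n" for g by (simp add: D_def)
  define W where "W = mat_adjoint V * U"
  have W: "W \<in> carrier_mat n n" unfolding W_def using V' U(1) by (rule mult_carrier_mat)
  have "W * D d = mat_adjoint V * (U * D d * mat_adjoint U) * U"
    unfolding W_def using U V' U' by (simp add: assoc mc right_mult_one_mat[OF D])
  also have "\<dots> = (mat_adjoint V * V) * D e * (mat_adjoint V * U)"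
    unfolding D_def eq unfolding D_def[symmetric] using U(1) V(1) V' U' by (simp add: assoc mc)
  finally have WD: "W * D d = D e * W" unfolding W_def[symmetric] by (simp add: V left_mult_one_mat[OF D])
  have "W * D (\<lambda>i. f (d i)) = D (\<lambda>i. f (e i)) * W"
  proof (rule eq_matI)
    fix i j assume "i < dim_row (D (\<lambda>i. f (e i)) * W)" "j < dim_col (D (\<lambda>i. f (e i)) * W)"
    then have ij: "i < n" "j < n" using W by (auto simp: D_def mat_diag_def)
    \<comment> \<open>Entrywise, \<open>W\<close> can be nonzero only where the two eigenvalues
      agree, and there \<open>f\<close> agrees too.\<close>
    have "W $$ (i, j) * complex_of_real (d j) = complex_of_real (e i) * W $$ (i, j)"
      using arg_cong[OF WD, of "\<lambda>M. M $$ (i, j)"] ij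
      by (simp add: D_def mat_diag_mult_left[OF W] mat_diag_mult_right[OF W])
    then have "W $$ (i, j) = 0 \<or> d j = e i" by auto
    then show "(W * D (\<lambda>i. f (d i))) $$ (i, j) = (D (\<lambda>i. f (e i)) * W) $$ (i, j)"
      using ij by (auto simp: D_def mat_diag_mult_left[OF W] mat_diag_mult_right[OF W])
  qed (use W in \<open>auto simp: D_def mat_diag_mult_left[OF W] mat_diag_mult_right[OF W]\<close>)
  then have "V * (W * D (\<lambda>i. f (d i))) * mat_adjoint U = V * (D (\<lambda>i. f (e i)) * W) * mat_adjoint U"
    by simp
  moreover have "V * (W * D (\<lambda>i. f (d i))) * mat_adjoint U
      = (V * mat_adjoint V) * U * D (\<lambda>i. f (d i)) * mat_adjoint U"
    unfolding W_def using U(1) V(1) V' U' by (simp add: assoc mc)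
  moreover have "V * (D (\<lambda>i. f (e i)) * W) * mat_adjoint U
      = V * D (\<lambda>i. f (e i)) * mat_adjoint V * (U * mat_adjoint U)"
    unfolding W_def using U(1) V(1) V' U' by (simp add: assoc mc)
  ultimately show ?thesis
    by (simp add: UU' VV' left_mult_one_mat[OF U(1)] D_def[symmetric]
        right_mult_one_mat[OF mult_carrier_mat[OF mult_carrier_mat[OF V(1) D] V']])
qed

text \<open>Turns the definite description into a computation rule: the given diagonalisation is a
  witness, and the functional calculus of the logarithm extended by 0 at 0 shows that there is no
  other value.\<close>

lemma mat_log_diagonalisation:
  assumes "U \<in> carrier_mat n n" "mat_adjoint U * U = 1\<^sub>m n" "\<forall>i<n. 0 \<le> d i"
    and "A = U * mat_diag n (\<lambda>i. complex_of_real (d i)) * mat_adjoint U"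
  shows "mat_log b A
       = U * mat_diag n (\<lambda>i. complex_of_real (if d i = 0 then 0 else log b (d i))) * mat_adjoint U"
proof -
  have n: "dim_row A = n" using assms by simp
  show ?thesis
    unfolding mat_log_def n Let_def
  proof (rule the_equality)
    fix L assume "\<exists>V e. V \<in> carrier_mat n n \<and> mat_adjoint V * V = 1\<^sub>m n \<and> (\<forall>i<n. 0 \<le> e i) \<and>
      A = V * mat_diag n (\<lambda>i. complex_of_real (e i)) * mat_adjoint V \<and>
      L = V * mat_diag n (\<lambda>i. complex_of_real (if e i = 0 then 0 else log b (e i))) * mat_adjoint V"
    then obtain V e where V: "V \<in> carrier_mat n n" "mat_adjoint V * V = 1\<^sub>m n"
      and A: "A = V * mat_diag n (\<lambda>i. complex_of_real (e i)) * mat_adjoint V"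
      and L: "L = V * mat_diag n (\<lambda>i. complex_of_real (if e i = 0 then 0 else log b (e i))) * mat_adjoint V"
      by blast
    show "L = U * mat_diag n (\<lambda>i. complex_of_real (if d i = 0 then 0 else log b (d i))) * mat_adjoint U"
      unfolding L
      using A assms(4)
      by (intro diagonalisation_functional_calculus_unique[OF V assms(1,2),
            where f = "\<lambda>x. if x = 0 then 0 else log b x"]) simp
  qed (use assms in blast)
qed

lemma mat_log_carrier:
  assumes "A \<in> psd n"
  shows "mat_log b A \<in> carrier_mat n n"
proof -
  obtain U d where U: "U \<in> carrier_mat n n" "mat_adjoint U * U = 1\<^sub>m n" "\<forall>i<n. 0 \<le> (d i :: real)"
    "A = U * mat_diag n (\<lambda>i. complex_of_real (d i)) * mat_adjoint U"
    using psd_diagonalisation[OF assms] by blast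
  show ?thesis unfolding mat_log_diagonalisation[OF U]
    using U(1) by (intro mult_carrier_mat[of _ n n] mat_adjoint_carrier) auto
qed

text \<open>Here \<open>P\<close> is the orthogonal projection onto the support of \<open>A\<close>.\<close>

lemma mat_log_smult:
  assumes A: "A \<in> psd n" and c: "0 < c" and b: "1 < b"
  obtains P where "P \<in> carrier_mat n n" "A * P = A"
    "mat_log b (complex_of_real c \<cdot>\<^sub>m A) = mat_log b A + complex_of_real (log b c) \<cdot>\<^sub>m P"
proof -
  obtain U d where U: "U \<in> carrier_mat n n" "mat_adjoint U * U = 1\<^sub>m n" and d: "\<forall>i<n. 0 \<le> (d i :: real)"
    and A_eq: "A = U * mat_diag n (\<lambda>i. complex_of_real (d i)) * mat_adjoint U"
    using psd_diagonalisation[OF A] by blast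
  note U' = mat_adjoint_carrier[OF U(1)]
  note assoc = assoc_mult_mat[of _ n n _ n _ n] and mc = mult_carrier_mat[of _ n n _ n]
  define D where "D g = mat_diag n (\<lambda>i. complex_of_real (g i))" for g :: "nat \<Rightarrow> real"
  have D [simp]: "D g \<in> carrier_mat n n" for g by (simp add: D_def)
  have D_smult: "z \<cdot>\<^sub>m D g = mat_diag n (\<lambda>i. z * complex_of_real (g i))" for z g
    by (intro eq_matI) (auto simp: D_def mat_diag_def)
  have D_add: "D g + D h = D (\<lambda>i. g i + h i)" for g h
    by (intro eq_matI) (auto simp: D_def mat_diag_def)
  have D_mult: "D g * D h = D (\<lambda>i. g i * h i)" for g h
    by (simp add: D_def)
  have D_cong: "D g = D h" if "\<And>i. i < n \<Longrightarrow> g i = h i" for g h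
    using that by (intro eq_matI) (auto simp: D_def mat_diag_def)
  have smult: "z \<cdot>\<^sub>m (U * D g * mat_adjoint U) = U * (z \<cdot>\<^sub>m D g) * mat_adjoint U" for z g
    using U(1) U' by (simp add: mult_smult_distrib[of _ n n _ n] mult_smult_assoc_mat[of _ n n _ n] mc)
  \<comment> \<open>The eigenvalues of the support projection: 1 where \<open>d\<close> is nonzero,
    0 elsewhere.\<close>
  define s where "s i = (if d i = 0 then 0 else 1 :: real)" for i
  let ?l = "\<lambda>x. if x = 0 then 0 else log b x"
  define P where "P = U * D s * mat_adjoint U"
  have P: "P \<in> carrier_mat n n" using U(1) U' by (simp add: P_def mc)
  have "A * P = U * (D d * (mat_adjoint U * U) * D s) * mat_adjoint U"
    unfolding A_eq P_def D_def[symmetric] using U(1) U' by (simp add: assoc mc)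
  also have "D d * (mat_adjoint U * U) * D s = D d"
    using D_cong[of "\<lambda>i. d i * s i" d] by (simp add: U D_mult right_mult_one_mat[OF D] s_def)
  finally have AP: "A * P = A" by (simp add: A_eq D_def)
  have cd: "\<forall>i<n. 0 \<le> c * d i" using c d by simp
  have cA: "complex_of_real c \<cdot>\<^sub>m A = U * mat_diag n (\<lambda>i. complex_of_real (c * d i)) * mat_adjoint U"
    unfolding A_eq D_def[symmetric] smult D_smult by (simp add: D_def)
  have "mat_log b (complex_of_real c \<cdot>\<^sub>m A) = U * D (\<lambda>i. ?l (c * d i)) * mat_adjoint U"
    unfolding mat_log_diagonalisation[OF U cd cA] D_def ..
  \<comment> \<open>For d i = 0 both sides are 0, by the convention on the kernel; this is why
    \<open>s\<close>, and not the constant 1, multiplies log c.\<close>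
  also have "D (\<lambda>i. ?l (c * d i)) = D (\<lambda>i. ?l (d i) + log b c * s i)"
    using c b d by (intro D_cong) (auto simp: s_def log_mult less_le)
  also have "\<dots> = D (\<lambda>i. ?l (d i)) + complex_of_real (log b c) \<cdot>\<^sub>m D s"
    unfolding D_smult D_add[symmetric] by (simp add: D_def)
  also have "U * \<dots> * mat_adjoint U
      = U * D (\<lambda>i. ?l (d i)) * mat_adjoint U + complex_of_real (log b c) \<cdot>\<^sub>m P"
    unfolding P_def smult using U(1) U'
    by (simp add: mult_add_distrib_mat[of _ n n _ n] add_mult_distrib_mat[of _ n n _ _ n] mc)
  also have "U * D (\<lambda>i. ?l (d i)) * mat_adjoint U = mat_log b A"
    unfolding mat_log_diagonalisation[OF U d A_eq] D_def ..
  finally show ?thesis using that[OF P AP] by simp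
qed

section \<open>Relative entropy under scaling of the second argument\<close>

lemma mat_trace_add:
  assumes "A \<in> carrier_mat n n" "B \<in> carrier_mat n n"
  shows "mat_trace (A + B) = mat_trace A + mat_trace B"
  using assms by (simp add: mat_trace_def sum.distrib)

lemma mat_trace_smult:
  assumes "A \<in> carrier_mat n n"
  shows "mat_trace (z \<cdot>\<^sub>m A) = z * mat_trace A"
  using assms by (simp add: mat_trace_def sum_distrib_left)

text \<open>\<open>supp\<close> is the orthogonal complement of the kernel; a Hermitian matrix moves
  across the inner product onto the kernel vector and annihilates it.\<close>

lemma mult_mat_vec_in_supp:
  assumes A: "A \<in> psd n" and x: "x \<in> carrier_vec n"
  shows "A *\<^sub>v x \<in> supp A"
proof -
  note c = psd_carrier[OF A]
  have "(A *\<^sub>v x) \<bullet>c w = 0" if "w \<in> mat_kernel A" for w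
    using that c x by (simp add: cscalar_prod_adjoint[OF c x] mat_kernel_def psd_hermitian[OF A])
  then show ?thesis using c x by (auto simp: supp_def)
qed

text \<open>The columns of 1 - P lie in the kernel of sigma, hence are orthogonal to supp sigma and
  so to the range of rho. As rho is Hermitian, it annihilates them.\<close>

lemma mult_eq_if_supp_subset:
  assumes \<rho>: "\<rho> \<in> psd n" and \<sigma>: "\<sigma> \<in> psd n" and sub: "supp \<rho> \<subseteq> supp \<sigma>"
    and P: "P \<in> carrier_mat n n" "\<sigma> * P = \<sigma>"
  shows "\<rho> * P = \<rho>"
proof -
  note r = psd_carrier[OF \<rho>] and s = psd_carrier[OF \<sigma>]
  define Q where "Q = 1\<^sub>m n - P"
  have Q: "Q \<in> carrier_mat n n" using minus_carrier_mat[OF P(1)] by (simp add: Q_def)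
  have "\<sigma> * Q = \<sigma> * 1\<^sub>m n - \<sigma> * P"
    unfolding Q_def by (rule mult_minus_distrib_mat[OF s one_carrier_mat P(1)])
  then have \<sigma>Q: "\<sigma> * Q = 0\<^sub>m n n" using s P(2) by simp
  have "\<rho> * Q = 0\<^sub>m n n"
  proof (rule eq_matI)
    fix i j assume "i < dim_row (0\<^sub>m n n :: complex mat)" "j < dim_col (0\<^sub>m n n :: complex mat)"
    then have ij: "i < n" "j < n" by auto
    let ?w = "col Q j" and ?e = "unit_vec n i :: complex vec"
    have w: "?w \<in> carrier_vec n" using Q ij by auto
    have "\<sigma> *\<^sub>v ?w = 0\<^sub>v n"
      unfolding col_mult2[OF s Q ij(2), symmetric] \<sigma>Q using ij by auto
    then have "?w \<in> mat_kernel \<sigma>" using s w by (simp add: mat_kernel_def)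
    moreover have "\<rho> *\<^sub>v ?e \<in> supp \<sigma>" using mult_mat_vec_in_supp[OF \<rho>, of ?e] sub by auto
    ultimately have "(\<rho> *\<^sub>v ?e) \<bullet>c ?w = 0" by (simp add: supp_def)
    then have "?e \<bullet>c (\<rho> *\<^sub>v ?w) = 0"
      using cscalar_prod_adjoint[OF r _ w, of ?e] by (simp add: psd_hermitian[OF \<rho>])
    moreover have "?e \<bullet>c (\<rho> *\<^sub>v ?w) = cnj ((\<rho> *\<^sub>v ?w) $ i)"
      using ij r w by (subst scalar_prod_left_unit[of _ n]) auto
    ultimately have "(\<rho> *\<^sub>v ?w) $ i = 0" by simp
    then show "(\<rho> * Q) $$ (i, j) = 0\<^sub>m n n $$ (i, j)"
      using ij r Q by simp
  qed (use r Q in auto)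
  moreover have "\<rho> * Q = \<rho> * 1\<^sub>m n - \<rho> * P"
    unfolding Q_def by (rule mult_minus_distrib_mat[OF r one_carrier_mat P(1)])
  ultimately have *: "\<rho> - \<rho> * P = 0\<^sub>m n n" using r by simp
  show ?thesis
  proof (rule eq_matI)
    fix i j assume "i < dim_row \<rho>" "j < dim_col \<rho>"
    then show "(\<rho> * P) $$ (i, j) = \<rho> $$ (i, j)"
      using arg_cong[OF *, of "\<lambda>M. M $$ (i, j)"] r P by simp
  qed (use r P in auto)
qed

lemma supp_smult:
  assumes "A \<in> carrier_mat n n" "z \<noteq> 0"
  shows "supp (z \<cdot>\<^sub>m A) = supp A"
proof -
  have "z \<cdot>\<^sub>m A *\<^sub>v v = 0\<^sub>v n \<longleftrightarrow> A *\<^sub>v v = 0\<^sub>v n" if "v \<in> carrier_vec n" for v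
  proof -
    have "(z \<cdot>\<^sub>m A *\<^sub>v v) $ i = z * (A *\<^sub>v v) $ i" if "i < n" for i
      using assms \<open>v \<in> carrier_vec n\<close> that
      by (simp add: mult_mat_vec_sum[of _ n n] sum_distrib_left mult.assoc del: index_mult_mat_vec)
    then show ?thesis using assms by (auto simp: vec_eq_iff simp del: index_mult_mat_vec)
  qed
  then have "mat_kernel (z \<cdot>\<^sub>m A) = mat_kernel A"
    using assms by (auto simp: mat_kernel_def)
  then show ?thesis by (simp add: supp_def)
qed

text \<open>When the supports are nested, the correction is log c times tr (rho P) = tr rho = 1.
  Otherwise both sides are infinite, since scaling does not change the support and log c is
  finite.\<close>

theorem rel_entropy_smult:
  assumes \<rho>: "\<rho> \<in> states n" and \<sigma>: "\<sigma> \<in> psd n" and c: "0 < c" and b: "1 < b"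
  shows "rel_entropy b \<rho> (complex_of_real c \<cdot>\<^sub>m \<sigma>) = rel_entropy b \<rho> \<sigma> - ereal (log b c)"
proof (cases "supp \<rho> \<subseteq> supp \<sigma>")
  case False
  then show ?thesis using c supp_smult[OF psd_carrier[OF \<sigma>]] by (simp add: rel_entropy_def)
next
  case True
  have \<rho>': "\<rho> \<in> psd n" "mat_trace \<rho> = 1" using \<rho> by (auto simp: states_def)
  obtain P where P: "P \<in> carrier_mat n n" "\<sigma> * P = \<sigma>"
    "mat_log b (complex_of_real c \<cdot>\<^sub>m \<sigma>) = mat_log b \<sigma> + complex_of_real (log b c) \<cdot>\<^sub>m P"
    using mat_log_smult[OF \<sigma> c b] .
  note r = psd_carrier[OF \<rho>'(1)]
  let ?K = "mat_log b \<rho>" and ?L = "mat_log b \<sigma>" and ?z = "complex_of_real (log b c)"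
  have KL: "?K \<in> carrier_mat n n" "?L \<in> carrier_mat n n"
    by (simp_all add: mat_log_carrier \<rho>' \<sigma>)
  have "?K - (?L + ?z \<cdot>\<^sub>m P) = (?K - ?L) + (- ?z) \<cdot>\<^sub>m P"
    using KL P by (intro eq_matI) auto
  then have "\<rho> * (?K - (?L + ?z \<cdot>\<^sub>m P)) = \<rho> * (?K - ?L) + (- ?z) \<cdot>\<^sub>m (\<rho> * P)"
    using mult_add_distrib_mat[OF r minus_carrier_mat[OF KL(2)] smult_carrier_mat[OF P(1)]]
      mult_smult_distrib[OF r P(1)] by metis
  also have "\<rho> * P = \<rho>" by (rule mult_eq_if_supp_subset[OF \<rho>'(1) \<sigma> True P(1,2)])
  finally have "mat_trace (\<rho> * (?K - (?L + ?z \<cdot>\<^sub>m P))) = mat_trace (\<rho> * (?K - ?L)) - ?z"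
    using mat_trace_add[OF mult_carrier_mat[OF r minus_carrier_mat[OF KL(2)]] smult_carrier_mat[OF r]]
      mat_trace_smult[OF r] \<rho>'(2) by simp
  then show ?thesis
    using True c supp_smult[OF psd_carrier[OF \<sigma>]] by (simp add: rel_entropy_def P(3))
qed

subsection \<open>The completely depolarizing map\<close>

text \<open>Splits the index of a tensor product into the indices of its two factors.\<close>

lemma sum_lessThan_mult:
  fixes f :: "nat \<Rightarrow> 'a :: comm_monoid_add"
  shows "(\<Sum>p<r * m. f p) = (\<Sum>i<r. \<Sum>k<m. f (i * m + k))"
proof -
  have "(\<Sum>k = i * m..<i * m + m. f k) = (\<Sum>k<m. f (i * m + k))" for i
    using sum.shift_bounds_nat_ivl[of f 0 "i * m" m]
    by (simp add: lessThan_atLeast0 add.commute)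
  then show ?thesis unfolding sum.nat_group[symmetric] by simp
qed

lemma index_less_mult: "i * m + k < r * m" if "i < r" "k < m" for i k r m :: nat
proof -
  have "i * m + k < Suc i * m" using that by simp
  also have "\<dots> \<le> r * m" using that by (intro mult_right_mono) auto
  finally show ?thesis .
qed

lemma tensor_block_carrier [simp]: "tensor_block m Z i j \<in> carrier_mat m m"
  by (simp add: tensor_block_def)

lemma tensor_sum_carrier [simp]: "tensor_sum r m F \<in> carrier_mat (r * m) (r * m)"
  by (simp add: tensor_sum_def)

lemma tensor_sum_index:
  assumes "i < r" "j < r" "k < m" "l < m"
  shows "tensor_sum r m F $$ (i * m + k, j * m + l) = F i j $$ (k, l)"
  using assms by (simp add: tensor_sum_def index_less_mult)

text \<open>The sum over s is the partial trace over the input factor; the condition k = l is the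
  identity on the output factor.\<close>

lemma id_tensor_depolarizing_index:
  assumes "X \<in> carrier_mat (r * n) (r * n)" "i < r" "j < r" "k < m" "l < m"
  shows "id_tensor r n m (depolarizing n m) X $$ (i * m + k, j * m + l)
       = (if k = l then \<Sum>s<n. X $$ (i * n + s, j * n + s) else 0)"
  using assms by (simp add: id_tensor_def tensor_sum_index depolarizing_def mat_trace_def)
    (simp add: tensor_block_def)

text \<open>Its Kraus operators are \<open>e\<^sub>k e\<^sub>s\<^sup>*\<close>; \<open>w k s\<close> below is \<open>1 \<otimes> e\<^sub>s e\<^sub>k\<^sup>*\<close> applied to \<open>v\<close>.\<close>

lemma completely_positive_depolarizing: "completely_positive n m (depolarizing n m)"
  unfolding completely_positive_def
proof (intro allI impI ballI)
  fix r :: nat and X assume X: "X \<in> psd (r * n)"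
  note c = psd_carrier[OF X]
  let ?Z = "id_tensor r n m (depolarizing n m) X"
  have Z: "?Z \<in> carrier_mat (r * m) (r * m)" using c by (simp add: id_tensor_def)
  have "0 \<le> (?Z *\<^sub>v v) \<bullet>c v" if v: "v \<in> carrier_vec (r * m)" for v
  proof -
    define w where "w k s = vec (r * n) (\<lambda>t. if t mod n = s then v $ (t div n * m + k) else 0)" for k s
    have w: "w k s \<in> carrier_vec (r * n)" for k s by (simp add: w_def)
    have w_index: "w k s $ (i * n + t) = (if t = s then v $ (i * m + k) else 0)" if "i < r" "t < n" for i t k s
      using that by (simp add: w_def index_less_mult)
    let ?y = "\<lambda>i j k s. X $$ (i * n + s, j * n + s) * v $ (j * m + k) * cnj (v $ (i * m + k))"
    \<comment> \<open>\<open>w k s\<close> vanishes unless the second tensor index is s, so two of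
      the four sums collapse.\<close>
    have form: "(X *\<^sub>v w k s) \<bullet>c w k s = (\<Sum>i<r. \<Sum>j<r. ?y i j k s)" if s: "s < n" for k s
    proof -
      have "(X *\<^sub>v w k s) \<bullet>c w k s = (\<Sum>i<r. \<Sum>t<n. \<Sum>j<r. \<Sum>u<n.
          X $$ (i * n + t, j * n + u) * w k s $ (j * n + u) * cnj (w k s $ (i * n + t)))"
        unfolding sesquilinear_form_sum[OF c w w] sum_lessThan_mult ..
      also have "\<dots> = (\<Sum>i<r. \<Sum>t<n. if t = s then \<Sum>j<r. \<Sum>u<n. if u = s then ?y i j k s else 0 else 0)"
      proof (intro sum.cong refl)
        fix i t assume i: "i \<in> {..<r}" and t: "t \<in> {..<n}"
        have "(\<Sum>u<n. X $$ (i * n + t, j * n + u) * w k s $ (j * n + u) * cnj (w k s $ (i * n + t)))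
            = (\<Sum>u<n. if u = s then if t = s then ?y i j k s else 0 else 0)" if "j < r" for j
          using i t that by (intro sum.cong refl) (auto simp: w_index)
        then have "(\<Sum>j<r. \<Sum>u<n. X $$ (i * n + t, j * n + u) * w k s $ (j * n + u) * cnj (w k s $ (i * n + t)))
            = (\<Sum>j<r. \<Sum>u<n. if u = s then if t = s then ?y i j k s else 0 else 0)"
          by (rule sum.cong[OF refl, of "{..<r}"]) simp
        then show "(\<Sum>j<r. \<Sum>u<n. X $$ (i * n + t, j * n + u) * w k s $ (j * n + u) * cnj (w k s $ (i * n + t)))
            = (if t = s then \<Sum>j<r. \<Sum>u<n. if u = s then ?y i j k s else 0 else 0)"
          using s by simp
      qed
      also have "\<dots> = (\<Sum>i<r. \<Sum>j<r. ?y i j k s)" using s by simp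
      finally show ?thesis .
    qed
    \<comment> \<open>Expanding this form and reordering the sums exhibits it as a sum over k and s
      of forms of \<open>X\<close> at \<open>w k s\<close>, each of them nonnegative.\<close>
    have "(?Z *\<^sub>v v) \<bullet>c v = (\<Sum>i<r. \<Sum>k<m. \<Sum>j<r. \<Sum>l<m.
        ?Z $$ (i * m + k, j * m + l) * v $ (j * m + l) * cnj (v $ (i * m + k)))"
      unfolding sesquilinear_form_sum[OF Z v v] sum_lessThan_mult ..
    also have "\<dots> = (\<Sum>i<r. \<Sum>k<m. \<Sum>j<r. \<Sum>l<m. if l = k then \<Sum>s<n. ?y i j k s else 0)"
      by (intro sum.cong refl) (auto simp: id_tensor_depolarizing_index[OF c] sum_distrib_right)
    also have "\<dots> = (\<Sum>i<r. \<Sum>k<m. \<Sum>j<r. \<Sum>s<n. ?y i j k s)" by simp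
    also have "\<dots> = (\<Sum>k<m. \<Sum>i<r. \<Sum>s<n. \<Sum>j<r. ?y i j k s)"
      unfolding sum.swap[of _ "{..<m}" "{..<r}"] by (rule sum.cong[OF refl], rule sum.cong[OF refl], rule sum.swap)
    also have "\<dots> = (\<Sum>k<m. \<Sum>s<n. (X *\<^sub>v w k s) \<bullet>c w k s)"
    proof (rule sum.cong[OF refl])
      fix k
      have "(\<Sum>i<r. \<Sum>s<n. \<Sum>j<r. ?y i j k s) = (\<Sum>s<n. \<Sum>i<r. \<Sum>j<r. ?y i j k s)"
        by (rule sum.swap)
      then show "(\<Sum>i<r. \<Sum>s<n. \<Sum>j<r. ?y i j k s) = (\<Sum>s<n. (X *\<^sub>v w k s) \<bullet>c w k s)"
        by (simp add: form)
    qed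
    also have "0 \<le> \<dots>"
      using X w by (intro sum_nonneg) (simp add: psd_def)
    finally show ?thesis .
  qed
  then show "?Z \<in> psd (r * m)" using Z by (simp add: psd_def)
qed

lemma smult_psd:
  assumes "A \<in> psd n" "0 \<le> c"
  shows "complex_of_real c \<cdot>\<^sub>m A \<in> psd n"
proof -
  note A = psd_carrier[OF assms(1)]
  have "0 \<le> (complex_of_real c \<cdot>\<^sub>m A *\<^sub>v v) \<bullet>c v" if v: "v \<in> carrier_vec n" for v
  proof -
    have "(complex_of_real c \<cdot>\<^sub>m A *\<^sub>v v) \<bullet>c v = complex_of_real c * ((A *\<^sub>v v) \<bullet>c v)"
      unfolding sesquilinear_form_sum[OF A v v] sesquilinear_form_sum[OF smult_carrier_mat[OF A] v v]
      using A by (auto simp: sum_distrib_left mult.assoc intro!: sum.cong)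
    moreover have "0 \<le> (A *\<^sub>v v) \<bullet>c v" using assms(1) v by (simp add: psd_def)
    ultimately show ?thesis using assms(2) by (simp add: less_eq_complex_def)
  qed
  then show ?thesis using A by (simp add: psd_def)
qed

lemma id_tensor_scale_map:
  assumes "N \<in> carrier_mat n n \<rightarrow> carrier_mat m m" "X \<in> carrier_mat (r * n) (r * n)"
  shows "id_tensor r n m (scale_map n z N) X = z \<cdot>\<^sub>m id_tensor r n m N X"
proof (rule eq_matI)
  fix p q assume "p < dim_row (z \<cdot>\<^sub>m id_tensor r n m N X)" "q < dim_col (z \<cdot>\<^sub>m id_tensor r n m N X)"
  then have pq: "p < r * m" "q < r * m" using assms by (auto simp: id_tensor_def tensor_sum_def)
  have "dim_row (N (tensor_block n X i j)) = m" "dim_col (N (tensor_block n X i j)) = m" for i j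
    using funcset_mem[OF assms(1) tensor_block_carrier] by auto
  \<comment> \<open>An index below r * m exists only if m is positive, and then p mod m is a
    legitimate index of the blocks.\<close>
  moreover have "0 < m" using pq(1) by (cases m) auto
  ultimately show "id_tensor r n m (scale_map n z N) X $$ (p, q) = (z \<cdot>\<^sub>m id_tensor r n m N X) $$ (p, q)"
    using pq assms by (simp add: id_tensor_def tensor_sum_def scale_map_def)
qed (use assms in \<open>auto simp: id_tensor_def tensor_sum_def\<close>)

lemma mat_trace_one: "mat_trace (1\<^sub>m n) = of_nat n"
  by (simp add: mat_trace_def)

text \<open>The depolarizing map multiplies traces by tr 1 = m, which the factor 1/m undoes.\<close>

lemma normalised_depolarizing_channel:
  assumes "0 < m"
  shows "scale_map n (complex_of_real (1 / real m)) (depolarizing n m) \<in> channels n m" (is "scale_map n ?z ?R \<in> _")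
proof -
  have R: "?R \<in> carrier_mat n n \<rightarrow> carrier_mat m m" by (auto simp: depolarizing_def)
  have "scale_map n ?z ?R \<in> lin_maps n m"
    by (auto simp: lin_maps_def depolarizing_def scale_map_def mat_trace_add[of _ n] mat_trace_smult[of _ n]
      intro!: eq_matI simp: algebra_simps)
  moreover have "completely_positive n m (scale_map n ?z ?R)"
    using completely_positive_depolarizing[of n m] smult_psd[of _ _ "1 / real m"]
    by (auto simp: completely_positive_def id_tensor_scale_map[OF R psd_carrier])
  moreover have "trace_preserving n (scale_map n ?z ?R)"
    using assms by (auto simp: trace_preserving_def scale_map_def depolarizing_def
        mat_trace_smult[of _ m] mat_trace_one)
  ultimately show ?thesis by (simp add: channels_def)
qed

subsection \<open>Channels and supermaps\<close>

lemma mat_trace_tensor_sum: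
  assumes "\<And>i. i < r \<Longrightarrow> F i i \<in> carrier_mat m m"
  shows "mat_trace (tensor_sum r m F) = (\<Sum>i<r. mat_trace (F i i))"
proof -
  have "mat_trace (tensor_sum r m F) = (\<Sum>i<r. \<Sum>k<m. tensor_sum r m F $$ (i * m + k, i * m + k))"
    using sum_lessThan_mult[of "\<lambda>p. tensor_sum r m F $$ (p, p)" r m]
    by (simp add: mat_trace_def tensor_sum_def)
  also have "\<dots> = (\<Sum>i<r. mat_trace (F i i))"
  proof (intro sum.cong refl)
    fix i assume "i \<in> {..<r}"
    then show "(\<Sum>k<m. tensor_sum r m F $$ (i * m + k, i * m + k)) = mat_trace (F i i)"
      using assms[of i] by (simp add: tensor_sum_index mat_trace_def)
  qed
  finally show ?thesis .
qed

lemma mat_trace_tensor_block_sum: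
  assumes "X \<in> carrier_mat (r * n) (r * n)"
  shows "(\<Sum>i<r. mat_trace (tensor_block n X i i)) = mat_trace X"
  using assms sum_lessThan_mult[of "\<lambda>p. X $$ (p, p)" r n]
  by (simp add: mat_trace_def) (simp add: tensor_block_def)

text \<open>Provides the unit trace of the first argument on which the exact shift by log c in
  \<open>rel_entropy_smult\<close> rests.\<close>

lemma id_tensor_channel_states:
  assumes N: "N \<in> channels n m" and "0 < r" and \<rho>: "\<rho> \<in> states (r * n)"
  shows "id_tensor r n m N \<rho> \<in> states (r * m)"
proof -
  have \<rho>': "\<rho> \<in> psd (r * n)" "mat_trace \<rho> = 1" using \<rho> by (auto simp: states_def)
  note c = psd_carrier[OF \<rho>'(1)]
  have NC: "N Y \<in> carrier_mat m m" "mat_trace (N Y) = mat_trace Y" if "Y \<in> carrier_mat n n" for Y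
    using N that by (auto simp: channels_def lin_maps_def trace_preserving_def)
  have "mat_trace (id_tensor r n m N \<rho>) = 1"
    using c \<rho>'(2) by (simp add: id_tensor_def mat_trace_tensor_sum NC mat_trace_tensor_block_sum)
  moreover have "id_tensor r n m N \<rho> \<in> psd (r * m)"
    using N \<open>0 < r\<close> \<rho>'(1) by (auto simp: channels_def completely_positive_def)
  ultimately show ?thesis by (simp add: states_def)
qed

text \<open>Only the diagonal blocks N(e_ii) contribute, and trace preservation gives each of them
  trace 1.\<close>

lemma mat_trace_choi:
  assumes "N \<in> channels n m"
  shows "mat_trace (choi n m N) = of_nat n"
proof -
  have NC: "N (matrix_unit n i i) \<in> carrier_mat m m" "mat_trace (N (matrix_unit n i i)) = 1" if "i < n" for i
  proof -
    have u: "matrix_unit n i i \<in> carrier_mat n n" by (simp add: matrix_unit_def)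
    then show "N (matrix_unit n i i) \<in> carrier_mat m m"
      using assms by (auto simp: channels_def lin_maps_def)
    have "mat_trace (matrix_unit n i i) = 1"
      using that by (simp add: matrix_unit_def mat_trace_def if_distrib sum.If_cases)
    then show "mat_trace (N (matrix_unit n i i)) = 1"
      using assms u by (simp add: channels_def trace_preserving_def)
  qed
  then show ?thesis by (simp add: choi_def mat_trace_tensor_sum)
qed

section \<open>Supermaps with a trivial reference system\<close>

lemma tensor_block_one: "Y \<in> carrier_mat n n \<Longrightarrow> tensor_block n Y 0 0 = Y"
  by (auto simp: tensor_block_def intro!: eq_matI)

lemma tensor_sum_one: "F 0 0 \<in> carrier_mat n n \<Longrightarrow> tensor_sum 1 n F = F 0 0"
  by (auto simp: tensor_sum_def intro!: eq_matI)

text \<open>With a one-dimensional reference only the component 0 0 0 0 remains. Equality as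
  functions also has to be checked outside the carrier, where extensionality makes both sides
  undefined.\<close>

lemma id_tensor_super_one:
  assumes N: "N \<in> carrier_mat a a \<rightarrow>\<^sub>E carrier_mat b b"
    and \<Theta>: "\<Theta> N \<in> carrier_mat c c \<rightarrow>\<^sub>E carrier_mat d d"
  shows "id_tensor_super 1 a b c d \<Theta> N = \<Theta> N"
proof -
  have "map_component 1 a b N 0 0 0 0 = N"
  proof
    fix X show "map_component 1 a b N 0 0 0 0 X = N X"
    proof (cases "X \<in> carrier_mat a a")
      case True
      then have "N X \<in> carrier_mat b b" by (rule PiE_mem[OF N])
      then show ?thesis
        using True tensor_sum_one[of "\<lambda>p q. if p = 0 \<and> q = 0 then X else 0\<^sub>m a a" a]
        by (simp add: map_component_def tensor_block_one)
    next
      case False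
      then show ?thesis by (simp add: map_component_def PiE_arb[OF N])
    qed
  qed
  then have comp: "map_component (Suc 0) a b N 0 0 0 0 = N" by simp
  show ?thesis
  proof
    fix Y show "id_tensor_super 1 a b c d \<Theta> N Y = \<Theta> N Y"
    proof (cases "Y \<in> carrier_mat c c")
      case True
      then have "\<Theta> N Y \<in> carrier_mat d d" by (rule PiE_mem[OF \<Theta>])
      moreover from this have "mat d d (\<lambda>pq. \<Theta> N Y $$ pq) = \<Theta> N Y" by (intro eq_matI) auto
      ultimately show ?thesis
        using True tensor_sum_one[of "\<lambda>k l. mat d d (\<lambda>pq. \<Theta> (map_component (Suc 0) a b N 0 0 k l) Y $$ pq)" d]
        by (simp add: id_tensor_super_def tensor_block_one comp)
    next
      case False
      then show ?thesis by (simp add: id_tensor_super_def PiE_arb[OF \<Theta>])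
    qed
  qed
qed

section \<open>From the scaled divergence to the entropy inequality\<close>

lemma scale_map_one:
  assumes "N \<in> carrier_mat n n \<rightarrow>\<^sub>E carrier_mat m m"
  shows "scale_map n 1 N = N"
proof
  fix X show "scale_map n 1 N X = N X"
    by (cases "X \<in> carrier_mat n n") (auto simp: scale_map_def PiE_arb[OF assms] intro!: eq_matI)
qed

text \<open>For each reference system and input state the two relative entropies differ by exactly
  log c, so the bound passes to the suprema.\<close>

lemma channel_divergence_scale_depolarizing:
  assumes N: "N \<in> channels n m" and c: "0 < c" and b: "1 < b"
  shows "channel_divergence b n m N (depolarizing n m)
    \<le> channel_divergence b n m N (scale_map n (complex_of_real c) (depolarizing n m)) + ereal (log b c)"
proof -
  let ?R = "depolarizing n m" and ?M = "scale_map n (complex_of_real c) (depolarizing n m)"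
  have R: "?R \<in> carrier_mat n n \<rightarrow> carrier_mat m m" by (auto simp: depolarizing_def)
  have "rel_entropy b (id_tensor r n m N \<rho>) (id_tensor r n m ?R \<rho>)
      \<le> channel_divergence b n m N ?M + ereal (log b c)"
    if r: "r \<in> {0<..}" and \<rho>: "\<rho> \<in> states (r * n)" for r \<rho>
  proof -
    have \<rho>': "\<rho> \<in> psd (r * n)" using \<rho> by (simp add: states_def)
    have "id_tensor r n m ?R \<rho> \<in> psd (r * m)"
      using completely_positive_depolarizing[of n m] \<rho>' r by (auto simp: completely_positive_def)
    then have "rel_entropy b (id_tensor r n m N \<rho>) (id_tensor r n m ?M \<rho>)
        = rel_entropy b (id_tensor r n m N \<rho>) (id_tensor r n m ?R \<rho>) - ereal (log b c)"
      unfolding id_tensor_scale_map[OF R psd_carrier[OF \<rho>']]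
      using id_tensor_channel_states[OF N _ \<rho>] r c b by (intro rel_entropy_smult) auto
    moreover have "rel_entropy b (id_tensor r n m N \<rho>) (id_tensor r n m ?M \<rho>)
        \<le> channel_divergence b n m N ?M"
      unfolding channel_divergence_def by (rule SUP_upper2[OF r], rule SUP_upper[OF \<rho>])
    \<comment> \<open>Moving log c across the inequality is sound even for infinite divergences,
      because log c itself is finite.\<close>
    ultimately show ?thesis by (simp add: ereal_minus_le)
  qed
  then show ?thesis
    unfolding channel_divergence_def[of b n m N ?R] by (intro SUP_least)
qed

theorem proposition12:
  fixes base :: real and a a' c c' :: nat and N\<^sub>0 :: "complex mat \<Rightarrow> complex mat"
  assumes "1 < base"
    and "0 < a" and "0 < a'" and "0 < c" and "0 < c'"
    and "N\<^sub>0 \<in> channels c c'"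
  shows "superchannel_entropy base a a' c c' (replacer_superchannel a a' c N\<^sub>0)
           \<le> channel_entropy base c c' N\<^sub>0 + ereal (log base (real a))"
proof -
  let ?\<Theta> = "replacer_superchannel a a' c N\<^sub>0" and ?\<Gamma> = "depolarizing_super a a' c c'"
  let ?M = "scale_map c (complex_of_real (real a)) (depolarizing c c')"
  define N where "N = scale_map a (complex_of_real (1 / real a')) (depolarizing a a')"
  have N: "N \<in> channels a a'" unfolding N_def by (rule normalised_depolarizing_channel[OF assms(3)])
  have N_ext: "N \<in> carrier_mat a a \<rightarrow>\<^sub>E carrier_mat a' a'"
    and N\<^sub>0_ext: "N\<^sub>0 \<in> carrier_mat c c \<rightarrow>\<^sub>E carrier_mat c' c'"
    using N assms(6) by (auto simp: channels_def lin_maps_def)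
  \<comment> \<open>The Choi trace |A| cancels the factor 1/|A| of the replacer. The depolarizing
    supermap has no such factor, so there |A| survives and later yields log |A|.\<close>
  have \<Theta>: "?\<Theta> N = N\<^sub>0"
    using assms(2) by (simp add: replacer_superchannel_def mat_trace_choi[OF N] scale_map_one[OF N\<^sub>0_ext])
  have \<Gamma>: "?\<Gamma> N = ?M"
    by (simp add: depolarizing_super_def mat_trace_choi[OF N])
  have M_ext: "?M \<in> carrier_mat c c \<rightarrow>\<^sub>E carrier_mat c' c'"
    by (auto simp: scale_map_def depolarizing_def)
  have "channel_divergence base c c' N\<^sub>0 (depolarizing c c')
      \<le> channel_divergence base c c' N\<^sub>0 ?M + ereal (log base (real a))"
    using assms by (intro channel_divergence_scale_depolarizing) auto
  also have "channel_divergence base c c' N\<^sub>0 ?M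
      = channel_divergence base (1 * c) (1 * c') (id_tensor_super 1 a a' c c' ?\<Theta> N) (id_tensor_super 1 a a' c c' ?\<Gamma> N)"
    using id_tensor_super_one[of N a a' ?\<Theta> c c'] id_tensor_super_one[of N a a' ?\<Gamma> c c']
      N_ext N\<^sub>0_ext M_ext by (simp add: \<Theta> \<Gamma>)
  \<comment> \<open>Reference dimension 1 and the channel \<open>N\<close> are one admissible choice
    in the double supremum.\<close>
  also have "\<dots> \<le> superchannel_divergence base a a' c c' ?\<Theta> ?\<Gamma>"
    unfolding superchannel_divergence_def
    by (rule SUP_upper2[of 1], simp, rule SUP_upper) (use N in simp)
  finally have "channel_divergence base c c' N\<^sub>0 (depolarizing c c')
      \<le> superchannel_divergence base a a' c c' ?\<Theta> ?\<Gamma> + ereal (log base (real a))"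
    by (simp add: add_right_mono)
  \<comment> \<open>Negation reverses the inequality; the cases treat infinite divergences, for
    which terms cannot simply be moved across.\<close>
  then show ?thesis
    unfolding superchannel_entropy_def channel_entropy_def
    by (cases "superchannel_divergence base a a' c c' ?\<Theta> ?\<Gamma>";
        cases "channel_divergence base c c' N\<^sub>0 (depolarizing c c')") auto
qed

end
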